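(* Let $3\le\alpha<5$. Let $u$ be a smooth, rapidly decaying axisymmetric solution of the three-dimensional incompressible Navier--Stokes equations with viscosity $\nu>0$; set $G=\omega^\theta/r$, $U=u^r/r$ and $U_+=\max(U,0)$. If the expansive strain satisfies $$\int U_+G^2r^\alpha\,dr\,dz\le\Lambda\int|G_r|^2r^\alpha\,dr\,dz ,$$ then the compression/transport contribution $\frac{\alpha-1}{2}\int UG^2r^\alpha\,dr\,dz$ in the weighted $G$-energy identity (recalled in the context) is strictly absorbed by the radial diffusion gap whenever $$\Lambda<\frac{2\nu(5-\alpha)}{(\alpha-1)^2} ;$$ that is, there is then $\theta\in[0,1)$ with $$\frac{\alpha-1}{2}\int U_+G^2r^\alpha\,dr\,dz\le\theta\,\nu\,\frac{5-\alpha}{\alpha-1}\int|G_r|^2r^\alpha\,dr\,dz .$$ Over $3\le\alpha<5$ the admissible constant $\frac{2\nu(5-\alpha)}{(\alpha-1)^2}$ is maximal at $\alpha=3$, where it equals $\nu$. (The assertion concerns only the transport/compression term, not the source term $2\int\Gamma WG\,r^{\alpha-3}\,dr\,dz$.)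
   Context: Integrals are over $(r,z)\in(0,\infty)\times\mathbb R$ in cylindrical coordinates, with $u=u^re_r+u^\theta e_\theta+u^ze_z$, components depending on $(r,z,t)$, $\omega^\theta=\partial_zu^r-\partial_ru^z$; the integral inequalities are read at a fixed time. ``Smooth rapidly decaying'' means that $u$ is smooth as a Cartesian vector field, including across the axis, and that $u$ and its derivatives decay faster than any power of $|x|$, locally uniformly in $t$. With $\Gamma=ru^\theta$ and $W=\Gamma_z/r$, the weighted $G$-energy identity is $$\frac12\frac{d}{dt}\int G^2r^\alpha+\nu\int|\nabla G|^2r^\alpha+\nu\frac{(3-\alpha)(\alpha-1)}2\int G^2r^{\alpha-2}=\frac{\alpha-1}2\int UG^2r^\alpha+2\int\Gamma WG\,r^{\alpha-3}$$ (all integrals in $dr\,dz$). For $3\le\alpha<5$ the diffusion form satisfies, with sharp constant, $$\int|\nabla G|^2r^\alpha+\frac{(3-\alpha)(\alpha-1)}2\int G^2r^{\alpha-2}\ge\frac{5-\alpha}{\alpha-1}\int|\nabla G|^2r^\alpha ,$$ so the radial diffusion gap is $\nu\frac{5-\alpha}{\alpha-1}$. *)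

theory Defs
  imports "HOL-Analysis.Analysis"
begin

text \<open>
  Time-dependent fields on \<open>\<real>\<^sup>3\<close> are curried functions of time and position.  Time ranges over an
  interval \<open>I\<close> with nonempty interior; at an endpoint contained in \<open>I\<close> the time derivative is
  one-sided.
\<close>

definition partial_t :: "real set \<Rightarrow> (real \<Rightarrow> real^3 \<Rightarrow> 'a::real_normed_vector) \<Rightarrow> real \<Rightarrow> real^3 \<Rightarrow> 'a"
  where "partial_t I f t x = vector_derivative (\<lambda>s. f s x) (at t within I)"

definition partial_x :: "3 \<Rightarrow> (real \<Rightarrow> real^3 \<Rightarrow> 'a::real_normed_vector) \<Rightarrow> real \<Rightarrow> real^3 \<Rightarrow> 'a"
  where "partial_x k f t x = vector_derivative (\<lambda>h. f t (x + h *\<^sub>R axis k 1)) (at 0)"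

text \<open>
  Iterated partial derivatives: the letter \<open>None\<close> is the time direction and \<open>Some k\<close> the
  \<open>k\<close>-th Cartesian direction.
\<close>

primrec iterated_partial ::
    "real set \<Rightarrow> 3 option list \<Rightarrow> (real \<Rightarrow> real^3 \<Rightarrow> 'a::real_normed_vector) \<Rightarrow> real \<Rightarrow> real^3 \<Rightarrow> 'a"
  where
    "iterated_partial I [] f = f"
  | "iterated_partial I (d # ds) f =
       (case d of None \<Rightarrow> partial_t I | Some k \<Rightarrow> partial_x k) (iterated_partial I ds f)"

definition smooth_field :: "real set \<Rightarrow> (real \<Rightarrow> real^3 \<Rightarrow> 'a::real_normed_vector) \<Rightarrow> bool"
  where "smooth_field I f \<longleftrightarrow>
    (\<forall>ds. (\<lambda>(t, x). iterated_partial I ds f t x) differentiable_on (I \<times> UNIV))"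

text \<open>Only spatial derivatives are required to decay; smoothness is joint in time and space.\<close>

definition rapidly_decaying :: "real set \<Rightarrow> (real \<Rightarrow> real^3 \<Rightarrow> 'a::real_normed_vector) \<Rightarrow> bool"
  where "rapidly_decaying I f \<longleftrightarrow>
    (\<forall>K ks N. compact K \<longrightarrow> K \<subseteq> I \<longrightarrow>
      (\<exists>C. \<forall>t\<in>K. \<forall>x. norm x ^ N * norm (iterated_partial I (map Some ks) f t x) \<le> C))"

definition navier_stokes_solution :: "real set \<Rightarrow> real \<Rightarrow> (real \<Rightarrow> real^3 \<Rightarrow> real^3) \<Rightarrow> bool"
  where "navier_stokes_solution I \<nu> u \<longleftrightarrow>
    (\<exists>p :: real \<Rightarrow> real^3 \<Rightarrow> real. smooth_field I p \<and>
      (\<forall>t\<in>I. \<forall>x.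
        partial_t I u t x + (\<Sum>k\<in>UNIV. (u t x $ k) *\<^sub>R partial_x k u t x)
          = \<nu> *\<^sub>R (\<Sum>k\<in>UNIV. partial_x k (partial_x k u) t x) - (\<chi> k. partial_x k p t x) \<and>
        (\<Sum>k\<in>UNIV. partial_x k u t x $ k) = 0))"

definition cyl_er :: "real \<Rightarrow> real^3"
  where "cyl_er \<phi> = vector [cos \<phi>, sin \<phi>, 0]"

definition cyl_etheta :: "real \<Rightarrow> real^3"
  where "cyl_etheta \<phi> = vector [- sin \<phi>, cos \<phi>, 0]"

definition cyl_ez :: "real^3"
  where "cyl_ez = vector [0, 0, 1]"

text \<open>
  \<open>ur\<close>, \<open>uth\<close>, \<open>uz\<close> (arguments: time, then \<open>r\<close> and \<open>z\<close>) are the cylindrical components of \<open>u\<close>.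
  That they do not take the angle \<open>\<phi>\<close> as an argument is the axisymmetry of \<open>u\<close>; swirl is allowed.
  The frame is undefined on the axis, so only \<open>r > 0\<close> is constrained.
\<close>

definition axisymmetric_with ::
    "real set \<Rightarrow> (real \<Rightarrow> real^3 \<Rightarrow> real^3) \<Rightarrow>
     (real \<Rightarrow> real \<Rightarrow> real \<Rightarrow> real) \<Rightarrow> (real \<Rightarrow> real \<Rightarrow> real \<Rightarrow> real) \<Rightarrow> (real \<Rightarrow> real \<Rightarrow> real \<Rightarrow> real) \<Rightarrow> bool"
  where "axisymmetric_with I u ur uth uz \<longleftrightarrow>
    (\<forall>t\<in>I. \<forall>r>0. \<forall>\<phi> z.
      u t (r *\<^sub>R cyl_er \<phi> + z *\<^sub>R cyl_ez)
        = ur t r z *\<^sub>R cyl_er \<phi> + uth t r z *\<^sub>R cyl_etheta \<phi> + uz t r z *\<^sub>R cyl_ez)"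

definition omega_theta ::
    "(real \<Rightarrow> real \<Rightarrow> real \<Rightarrow> real) \<Rightarrow> (real \<Rightarrow> real \<Rightarrow> real \<Rightarrow> real) \<Rightarrow> real \<Rightarrow> real \<Rightarrow> real \<Rightarrow> real"
  where "omega_theta ur uz t r z = deriv (\<lambda>\<zeta>. ur t r \<zeta>) z - deriv (\<lambda>\<rho>. uz t \<rho> z) r"

definition G_of ::
    "(real \<Rightarrow> real \<Rightarrow> real \<Rightarrow> real) \<Rightarrow> (real \<Rightarrow> real \<Rightarrow> real \<Rightarrow> real) \<Rightarrow> real \<Rightarrow> real \<Rightarrow> real \<Rightarrow> real"
  where "G_of ur uz t r z = omega_theta ur uz t r z / r"

definition U_of :: "(real \<Rightarrow> real \<Rightarrow> real \<Rightarrow> real) \<Rightarrow> real \<Rightarrow> real \<Rightarrow> real \<Rightarrow> real"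
  where "U_of ur t r z = ur t r z / r"

definition r_deriv :: "(real \<Rightarrow> real \<Rightarrow> real) \<Rightarrow> real \<Rightarrow> real \<Rightarrow> real"
  where "r_deriv g r z = deriv (\<lambda>\<rho>. g \<rho> z) r"

definition half_plane_integral :: "(real \<Rightarrow> real \<Rightarrow> real) \<Rightarrow> real"
  where "half_plane_integral f = (LINT (r, z):{0<..} \<times> UNIV|lborel. f r z)"

end

theory Submission
  imports Defs
begin

text \<open>
  Write \<open>P\<close> for the weighted integral of \<open>U\<^sub>+ G\<^sup>2\<close> and \<open>D\<close> for that of \<open>G\<^sub>r\<^sup>2\<close>.
  The factor \<open>(\<alpha> - 1) / 2\<close> of the transport term and the coefficient \<open>\<nu> (5 - \<alpha>) / (\<alpha> - 1)\<close>
  of the diffusion gap have quotient \<open>1 / L\<close> with \<open>L = 2 \<nu> (5 - \<alpha>) / (\<alpha> - 1)\<^sup>2\<close>, so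
  \<open>P \<le> \<Lambda> D\<close> says that the expansive part of the transport term is at most \<open>\<Lambda> / L\<close> times the gap.
  Since \<open>D \<ge> 0\<close>, a negative \<open>\<Lambda>\<close> may be replaced by \<open>0\<close>, and \<open>\<theta> = max 0 (\<Lambda> / L)\<close> is the
  absorbed fraction (\<open>strict_absorption\<close>).

  The signed transport term is dominated by its expansive part, because the weight \<open>G\<^sup>2 r\<^sup>\<alpha>\<close> is
  nonnegative and the compressive part of \<open>U\<close> only lowers the integral
  (\<open>half_plane_integral_le_positive_part\<close>).  Finally, on \<open>[3, 5)\<close> the numerator of
  \<open>2 \<nu> (5 - \<beta>) / (\<beta> - 1)\<^sup>2\<close> decreases in \<open>\<beta>\<close> and its denominator increases, which places the
  maximum at the left endpoint.
\<close>

lemma half_plane_integral_nonneg: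
  assumes "\<And>r z. 0 < r \<Longrightarrow> 0 \<le> f r z"
  shows "0 \<le> half_plane_integral f"
  unfolding half_plane_integral_def set_lebesgue_integral_def
  by (rule Bochner_Integration.integral_nonneg) (auto simp: indicator_def assms)

text \<open>
  The positive part of an integrable function is integrable, so the integrals compare by
  monotonicity.  A function that is not integrable has Bochner integral \<open>0\<close>, which is still
  at most the integral of the nonnegative function \<open>max f 0\<close>.
\<close>

lemma half_plane_integral_le_positive_part:
  "half_plane_integral f \<le> half_plane_integral (\<lambda>r z. max (f r z) 0)"
proof -
  let ?H = "{0<..} \<times> UNIV :: (real \<times> real) set"
  let ?g = "\<lambda>p. indicator ?H p *\<^sub>R (case p of (r, z) \<Rightarrow> f r z)"
  have positive_part: "half_plane_integral (\<lambda>r z. max (f r z) 0) = (LINT p|lborel. max (?g p) 0)"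
    unfolding half_plane_integral_def set_lebesgue_integral_def
    by (intro Bochner_Integration.integral_cong) (auto simp: indicator_def)
  have "(LINT p|lborel. ?g p) \<le> (LINT p|lborel. max (?g p) 0)"
  proof (cases "integrable lborel ?g")
    case True
    then show ?thesis
      by (intro integral_mono integrable_max) auto
  next
    case False
    then have "(LINT p|lborel. ?g p) = 0"
      by (rule not_integrable_integral_eq)
    then show ?thesis
      by (simp add: Bochner_Integration.integral_nonneg)
  qed
  then show ?thesis
    unfolding positive_part
    by (simp add: half_plane_integral_def set_lebesgue_integral_def)
qed

text \<open>
  If \<open>c > 0\<close> is the coefficient of the production term and \<open>d > 0\<close> that of the dissipation, then
  \<open>d / c\<close> is the threshold below which a relative bound \<open>P \<le> \<Lambda> D\<close> leaves part of the
  dissipation over.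
\<close>

lemma strict_absorption:
  fixes c d P D \<Lambda> :: real
  assumes "0 < c" "0 < d" "0 \<le> D" and bound: "P \<le> \<Lambda> * D" and small: "\<Lambda> < d / c"
  shows "\<exists>\<theta>. 0 \<le> \<theta> \<and> \<theta> < 1 \<and> c * P \<le> \<theta> * (d * D)"
proof -
  define \<theta> where "\<theta> = max 0 (\<Lambda> * c / d)"
  have "\<theta> < 1"
    using assms by (simp add: \<theta>_def field_simps)
  moreover have "c * P \<le> \<theta> * (d * D)"
  proof -
    have "c * P \<le> c * (\<Lambda> * D)"
      using \<open>0 < c\<close> bound by (simp add: mult_left_mono)
    also have "\<dots> = \<Lambda> * c / d * (d * D)"
      using \<open>0 < d\<close> by simp
    also have "\<dots> \<le> \<theta> * (d * D)"
      using \<open>0 < d\<close> \<open>0 \<le> D\<close> unfolding \<theta>_def by (intro mult_right_mono) auto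
    finally show ?thesis .
  qed
  moreover have "0 \<le> \<theta>"
    by (simp add: \<theta>_def)
  ultimately show ?thesis
    by blast
qed

lemma admissible_constant_le:
  fixes \<nu> \<beta> :: real
  assumes "0 \<le> \<nu>" "3 \<le> \<beta>"
  shows "2 * \<nu> * (5 - \<beta>) / (\<beta> - 1)\<^sup>2 \<le> 2 * \<nu> * (5 - 3) / (3 - 1)\<^sup>2"
proof (rule frac_le)
  show "2 * \<nu> * (5 - \<beta>) \<le> 2 * \<nu> * (5 - 3)"
    using assms by (intro mult_left_mono) auto
  show "(3 - 1)\<^sup>2 \<le> (\<beta> - 1)\<^sup>2"
    using assms by (intro power_mono) auto
qed (use assms in auto)

theorem corollary6p3:
  fixes \<alpha> \<nu> \<Lambda> t :: real
    and I :: "real set"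
    and u :: "real \<Rightarrow> real^3 \<Rightarrow> real^3"
    and ur uth uz :: "real \<Rightarrow> real \<Rightarrow> real \<Rightarrow> real"
    and G U :: "real \<Rightarrow> real \<Rightarrow> real"
  assumes alpha: "3 \<le> \<alpha>" "\<alpha> < 5"
    and nu: "\<nu> > 0"
    and time: "is_interval I" "interior I \<noteq> {}" "t \<in> I"
    and smooth: "smooth_field I u"
    and decay: "rapidly_decaying I u"
    and axisymmetric: "axisymmetric_with I u ur uth uz"
    and solution: "navier_stokes_solution I \<nu> u"
    and G: "G = G_of ur uz t"
    and U: "U = U_of ur t"
  shows
    "(half_plane_integral (\<lambda>r z. max (U r z) 0 * (G r z)\<^sup>2 * r powr \<alpha>)
        \<le> \<Lambda> * half_plane_integral (\<lambda>r z. \<bar>r_deriv G r z\<bar>\<^sup>2 * r powr \<alpha>) \<longrightarrow>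
      \<Lambda> < 2 * \<nu> * (5 - \<alpha>) / (\<alpha> - 1)\<^sup>2 \<longrightarrow>
      (\<exists>\<theta>. 0 \<le> \<theta> \<and> \<theta> < 1 \<and>
        (\<alpha> - 1) / 2 * half_plane_integral (\<lambda>r z. U r z * (G r z)\<^sup>2 * r powr \<alpha>)
          \<le> \<theta> * (\<nu> * ((5 - \<alpha>) / (\<alpha> - 1))
              * half_plane_integral (\<lambda>r z. \<bar>r_deriv G r z\<bar>\<^sup>2 * r powr \<alpha>)) \<and>
        (\<alpha> - 1) / 2 * half_plane_integral (\<lambda>r z. max (U r z) 0 * (G r z)\<^sup>2 * r powr \<alpha>)
          \<le> \<theta> * (\<nu> * ((5 - \<alpha>) / (\<alpha> - 1))
              * half_plane_integral (\<lambda>r z. \<bar>r_deriv G r z\<bar>\<^sup>2 * r powr \<alpha>))))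
     \<and> (\<forall>\<beta>. 3 \<le> \<beta> \<longrightarrow> \<beta> < 5 \<longrightarrow>
          2 * \<nu> * (5 - \<beta>) / (\<beta> - 1)\<^sup>2 \<le> 2 * \<nu> * (5 - 3) / (3 - 1)\<^sup>2)
     \<and> 2 * \<nu> * (5 - 3) / (3 - 1)\<^sup>2 = \<nu>"
proof -
  let ?P = "half_plane_integral (\<lambda>r z. max (U r z) 0 * (G r z)\<^sup>2 * r powr \<alpha>)"
  let ?T = "half_plane_integral (\<lambda>r z. U r z * (G r z)\<^sup>2 * r powr \<alpha>)"
  let ?D = "half_plane_integral (\<lambda>r z. \<bar>r_deriv G r z\<bar>\<^sup>2 * r powr \<alpha>)"
  let ?c = "(\<alpha> - 1) / 2" and ?d = "\<nu> * ((5 - \<alpha>) / (\<alpha> - 1))"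
  have coefficients: "0 < ?c" "0 < ?d"
    using alpha nu by simp_all
  have threshold: "2 * \<nu> * (5 - \<alpha>) / (\<alpha> - 1)\<^sup>2 = ?d / ?c"
    by (simp add: power2_eq_square)
  have "max (U r z * (G r z)\<^sup>2 * r powr \<alpha>) 0 = max (U r z) 0 * (G r z)\<^sup>2 * r powr \<alpha>" for r z
    by (cases "0 \<le> U r z") (simp_all add: max_def mult_le_0_iff mult_nonneg_nonneg)
  then have "?T \<le> ?P"
    using half_plane_integral_le_positive_part[of "\<lambda>r z. U r z * (G r z)\<^sup>2 * r powr \<alpha>"] by simp
  then have transport: "?c * ?T \<le> ?c * ?P"
    using coefficients(1) by (intro mult_left_mono) auto
  have "0 \<le> ?D"
    by (rule half_plane_integral_nonneg) simp
  then have "\<exists>\<theta>. 0 \<le> \<theta> \<and> \<theta> < 1 \<and> ?c * ?T \<le> \<theta> * (?d * ?D) \<and> ?c * ?P \<le> \<theta> * (?d * ?D)"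
    if "?P \<le> \<Lambda> * ?D" "\<Lambda> < 2 * \<nu> * (5 - \<alpha>) / (\<alpha> - 1)\<^sup>2"
    using strict_absorption[OF coefficients _ that(1)] that(2) transport
    unfolding threshold by (meson order_trans)
  moreover have "2 * \<nu> * (5 - 3) / (3 - 1)\<^sup>2 = \<nu>"
    by simp
  ultimately show ?thesis
    using admissible_constant_le[of \<nu>] nu by (meson less_imp_le)
qed

end
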